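(* Let $N\ge2$ and let $(\mu,(f_i)_{i\in\mathbb{Z}_N})$ and $(\mu',(f_i')_{i\in\mathbb{Z}_N})$ be two nonnegative monic systems. Then the two associated representations of $\mathcal{O}_N$ are disjoint if and only if the measures $\mu$ and $\mu'$ are mutually singular.
   Context: Let $\mathbb{Z}_N=\{0,1,\dots,N-1\}$. A representation of $\mathcal{O}_N$ on a Hilbert space is a family of isometries $(S_i)_{i\in\mathbb{Z}_N}$ with $S_i^*S_j=\delta_{ij}I$ and $\sum_{i}S_iS_i^*=I$. Two representations $(S_i)$ on $\mathcal{H}$ and $(S_i')$ on $\mathcal{H}'$ are disjoint if the only bounded operator $W:\mathcal{H}\to\mathcal{H}'$ intertwining them ($WS_i=S_i'W$ and $WS_i^*=S_i'^*W$ for all $i$) is $W=0$. Let $\mathcal{K}_N=\prod_1^\infty\mathbb{Z}_N$ be the compact space of infinite words (product topology), $\sigma(\omega_1\omega_2\dots)=\omega_2\omega_3\dots$, and $\sigma_i(\omega_1\omega_2\dots)=i\omega_1\omega_2\dots$ for $i\in\mathbb{Z}_N$. $\mu\circ\sigma_i^{-1}$ denotes the push-forward $A\mapsto\mu(\sigma_i^{-1}(A))$. A monic system is a pair $(\mu,(f_i)_{i\in\mathbb{Z}_N})$ where $\mu$ is a finite Borel measure on $\mathcal{K}_N$ with $\mu\circ\sigma_i^{-1}\ll\mu$ for all $i$, and $f_i\in L^2(\mu)$ are functions such that $\frac{d(\mu\circ\sigma_i^{-1})}{d\mu}=|f_i|^2$ and $f_i(x)\ne0$ for $\mu$-a.e.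 $x\in\sigma_i(\mathcal{K}_N)$. It is nonnegative if $f_i\ge0$ for all $i$. The representation of $\mathcal{O}_N$ associated to the monic system is the one on $L^2(\mu)$ given by $S_if=f_i\,(f\circ\sigma)$. *)

theory Defs
  imports "HOL-Analysis.Analysis"
begin

text \<open>
  Complex \<open>L\<^sup>2\<close> spaces. An element of \<open>L\<^sup>2(M)\<close> is given by a
  representative, and equality in \<open>L\<^sup>2(M)\<close> is equality almost everywhere
  (\<^term>\<open>l2_eq\<close>). An operator is a map on representatives that respects this
  equality; every operator on the quotient arises in this way, and equations between
  operators are read up to \<^term>\<open>l2_eq\<close>.
\<close>

definition l2_space :: "'a measure \<Rightarrow> ('a \<Rightarrow> complex) set" where
  "l2_space M = {g \<in> borel_measurable M. integrable M (\<lambda>x. (cmod (g x))\<^sup>2)}"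

definition l2_eq :: "'a measure \<Rightarrow> ('a \<Rightarrow> complex) \<Rightarrow> ('a \<Rightarrow> complex) \<Rightarrow> bool" where
  "l2_eq M g h \<longleftrightarrow> (AE x in M. g x = h x)"

definition l2_inner :: "'a measure \<Rightarrow> ('a \<Rightarrow> complex) \<Rightarrow> ('a \<Rightarrow> complex) \<Rightarrow> complex" where
  "l2_inner M g h = (LINT x|M. cnj (g x) * h x)"

definition l2_norm :: "'a measure \<Rightarrow> ('a \<Rightarrow> complex) \<Rightarrow> real" where
  "l2_norm M g = sqrt (LINT x|M. (cmod (g x))\<^sup>2)"

definition bounded_operator ::
  "'a measure \<Rightarrow> 'b measure \<Rightarrow> (('a \<Rightarrow> complex) \<Rightarrow> 'b \<Rightarrow> complex) \<Rightarrow> bool" where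
  "bounded_operator M M' W \<longleftrightarrow>
     (\<forall>g\<in>l2_space M. W g \<in> l2_space M') \<and>
     (\<forall>g\<in>l2_space M. \<forall>h\<in>l2_space M. l2_eq M g h \<longrightarrow> l2_eq M' (W g) (W h)) \<and>
     (\<forall>g\<in>l2_space M. \<forall>h\<in>l2_space M.
        l2_eq M' (W (\<lambda>x. g x + h x)) (\<lambda>y. W g y + W h y)) \<and>
     (\<forall>c. \<forall>g\<in>l2_space M. l2_eq M' (W (\<lambda>x. c * g x)) (\<lambda>y. c * W g y)) \<and>
     (\<exists>C. \<forall>g\<in>l2_space M. l2_norm M' (W g) \<le> C * l2_norm M g)"

definition is_adjoint ::
  "'a measure \<Rightarrow> 'b measure \<Rightarrow> (('a \<Rightarrow> complex) \<Rightarrow> 'b \<Rightarrow> complex) \<Rightarrow>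
   (('b \<Rightarrow> complex) \<Rightarrow> 'a \<Rightarrow> complex) \<Rightarrow> bool" where
  "is_adjoint M M' T A \<longleftrightarrow> bounded_operator M' M A \<and>
     (\<forall>g\<in>l2_space M. \<forall>h\<in>l2_space M'. l2_inner M' (T g) h = l2_inner M g (A h))"

text \<open>The adjoint is unique up to \<^term>\<open>l2_eq\<close> (lemma \<open>is_adjoint_unique\<close> below).\<close>

definition adjoint_op ::
  "'a measure \<Rightarrow> 'b measure \<Rightarrow> (('a \<Rightarrow> complex) \<Rightarrow> 'b \<Rightarrow> complex) \<Rightarrow>
   ('b \<Rightarrow> complex) \<Rightarrow> 'a \<Rightarrow> complex" where
  "adjoint_op M M' T = (SOME A. is_adjoint M M' T A)"

definition isometry_op ::
  "'a measure \<Rightarrow> 'b measure \<Rightarrow> (('a \<Rightarrow> complex) \<Rightarrow> 'b \<Rightarrow> complex) \<Rightarrow> bool" where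
  "isometry_op M M' T \<longleftrightarrow> bounded_operator M M' T \<and>
     (\<forall>g\<in>l2_space M. l2_norm M' (T g) = l2_norm M g)"

definition cuntz_representation ::
  "nat \<Rightarrow> 'a measure \<Rightarrow> (nat \<Rightarrow> ('a \<Rightarrow> complex) \<Rightarrow> 'a \<Rightarrow> complex) \<Rightarrow> bool" where
  "cuntz_representation N M S \<longleftrightarrow>
     (\<forall>i<N. isometry_op M M (S i)) \<and>
     (\<forall>i<N. \<forall>j<N. \<forall>g\<in>l2_space M.
        l2_eq M (adjoint_op M M (S i) (S j g)) (if i = j then g else (\<lambda>_. 0))) \<and>
     (\<forall>g\<in>l2_space M. l2_eq M (\<lambda>x. \<Sum>i<N. S i (adjoint_op M M (S i) g) x) g)"

definition intertwines ::
  "nat \<Rightarrow> 'a measure \<Rightarrow> (nat \<Rightarrow> ('a \<Rightarrow> complex) \<Rightarrow> 'a \<Rightarrow> complex) \<Rightarrow>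
   'b measure \<Rightarrow> (nat \<Rightarrow> ('b \<Rightarrow> complex) \<Rightarrow> 'b \<Rightarrow> complex) \<Rightarrow>
   (('a \<Rightarrow> complex) \<Rightarrow> 'b \<Rightarrow> complex) \<Rightarrow> bool" where
  "intertwines N M S M' S' W \<longleftrightarrow>
     (\<forall>i<N. \<forall>g\<in>l2_space M.
        l2_eq M' (W (S i g)) (S' i (W g)) \<and>
        l2_eq M' (W (adjoint_op M M (S i) g)) (adjoint_op M' M' (S' i) (W g)))"

definition disjoint_representations ::
  "nat \<Rightarrow> 'a measure \<Rightarrow> (nat \<Rightarrow> ('a \<Rightarrow> complex) \<Rightarrow> 'a \<Rightarrow> complex) \<Rightarrow>
   'b measure \<Rightarrow> (nat \<Rightarrow> ('b \<Rightarrow> complex) \<Rightarrow> 'b \<Rightarrow> complex) \<Rightarrow> bool" where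
  "disjoint_representations N M S M' S' \<longleftrightarrow>
     (\<forall>W. bounded_operator M M' W \<and> intertwines N M S M' S' W \<longrightarrow>
        (\<forall>g\<in>l2_space M. l2_eq M' (W g) (\<lambda>_. 0)))"

definition mutually_singular :: "'a measure \<Rightarrow> 'a measure \<Rightarrow> bool" where
  "mutually_singular M M' \<longleftrightarrow>
     (\<exists>A\<in>sets M \<inter> sets M'. emeasure M A = 0 \<and> emeasure M' (space M' - A) = 0)"

definition words :: "nat \<Rightarrow> (nat \<Rightarrow> nat) set" where
  "words N = {w. \<forall>n. w n < N}"

definition shift :: "(nat \<Rightarrow> nat) \<Rightarrow> nat \<Rightarrow> nat" where
  "shift w = (\<lambda>n. w (Suc n))"

definition prepend :: "nat \<Rightarrow> (nat \<Rightarrow> nat) \<Rightarrow> nat \<Rightarrow> nat" where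
  "prepend i w = (\<lambda>n. case n of 0 \<Rightarrow> i | Suc m \<Rightarrow> w m)"

text \<open>
  \<^term>\<open>borel\<close> on \<open>nat \<Rightarrow> nat\<close> refers to the product of the discrete
  topologies, so its restriction to \<^term>\<open>words N\<close> is the Borel \<open>\<sigma>\<close>-algebra of the
  compact space of words. \<^term>\<open>absolutely_continuous M M'\<close> is \<open>M' \<lless> M\<close>.
\<close>

definition monic_system ::
  "nat \<Rightarrow> (nat \<Rightarrow> nat) measure \<Rightarrow> (nat \<Rightarrow> (nat \<Rightarrow> nat) \<Rightarrow> complex) \<Rightarrow> bool" where
  "monic_system N \<mu> f \<longleftrightarrow>
     finite_measure \<mu> \<and>
     sets \<mu> = sets (restrict_space borel (words N)) \<and>
     (\<forall>i<N.
        absolutely_continuous \<mu> (distr \<mu> \<mu> (prepend i)) \<and>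
        f i \<in> l2_space \<mu> \<and>
        (AE x in \<mu>. RN_deriv \<mu> (distr \<mu> \<mu> (prepend i)) x = ennreal ((cmod (f i x))\<^sup>2)) \<and>
        (AE x in \<mu>. x \<in> prepend i ` words N \<longrightarrow> f i x \<noteq> 0))"

definition nonnegative_monic_system ::
  "nat \<Rightarrow> (nat \<Rightarrow> nat) measure \<Rightarrow> (nat \<Rightarrow> (nat \<Rightarrow> nat) \<Rightarrow> complex) \<Rightarrow> bool" where
  "nonnegative_monic_system N \<mu> f \<longleftrightarrow>
     monic_system N \<mu> f \<and> (\<forall>i<N. AE x in \<mu>. f i x \<in> \<real>\<^sub>\<ge>\<^sub>0)"

definition monic_representation ::
  "(nat \<Rightarrow> (nat \<Rightarrow> nat) \<Rightarrow> complex) \<Rightarrow>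
   nat \<Rightarrow> ((nat \<Rightarrow> nat) \<Rightarrow> complex) \<Rightarrow> (nat \<Rightarrow> nat) \<Rightarrow> complex" where
  "monic_representation f i g = (\<lambda>x. f i x * g (shift x))"


text \<open>The definitions are coherent: a monic system does give a representation.\<close>

lemma borel_measurable_cnj [measurable (raw)]:
  "g \<in> borel_measurable M \<Longrightarrow> (\<lambda>x. cnj (g x)) \<in> borel_measurable M"
  by (rule borel_measurable_continuous_on[OF continuous_on_cnj[OF continuous_on_id]])

lemma l2_integrable_mult:
  assumes g: "g \<in> l2_space M" and h: "h \<in> l2_space M"
  shows "integrable M (\<lambda>x. cnj (g x) * h x)"
proof -
  have [measurable]: "g \<in> borel_measurable M" "h \<in> borel_measurable M"
    using g h by (auto simp: l2_space_def)
  show ?thesis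
  proof (rule Bochner_Integration.integrable_bound)
    show "integrable M (\<lambda>x. (cmod (g x))\<^sup>2 + (cmod (h x))\<^sup>2)"
      using g h by (auto simp: l2_space_def)
    have "a * b \<le> a\<^sup>2 + b\<^sup>2" for a b :: real
    proof -
      have "0 \<le> (a - b)\<^sup>2" "0 \<le> (a + b)\<^sup>2" "0 \<le> a\<^sup>2" "0 \<le> b\<^sup>2" by auto
      then show ?thesis by (simp add: power2_eq_square algebra_simps)
    qed
    then show "AE x in M. norm (cnj (g x) * h x) \<le> norm ((cmod (g x))\<^sup>2 + (cmod (h x))\<^sup>2)"
      by (simp add: norm_mult)
  qed measurable
qed

lemma l2_diff:
  assumes g: "g \<in> l2_space M" and h: "h \<in> l2_space M"
  shows "(\<lambda>x. g x - h x) \<in> l2_space M"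
proof -
  have [measurable]: "g \<in> borel_measurable M" "h \<in> borel_measurable M"
    using g h by (auto simp: l2_space_def)
  have "integrable M (\<lambda>x. (cmod (g x - h x))\<^sup>2)"
  proof (rule Bochner_Integration.integrable_bound)
    show "integrable M (\<lambda>x. 2 * (cmod (g x))\<^sup>2 + 2 * (cmod (h x))\<^sup>2)"
      using g h by (auto simp: l2_space_def)
    have "(cmod (a - b))\<^sup>2 \<le> 2 * (cmod a)\<^sup>2 + 2 * (cmod b)\<^sup>2" for a b
    proof -
      have "(cmod (a - b))\<^sup>2 \<le> (cmod a + cmod b)\<^sup>2"
        by (rule power_mono[OF norm_triangle_ineq4]) simp
      moreover have "0 \<le> (cmod a - cmod b)\<^sup>2" by simp
      ultimately show ?thesis by (simp add: power2_eq_square algebra_simps)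
    qed
    then show "AE x in M. norm ((cmod (g x - h x))\<^sup>2)
        \<le> norm (2 * (cmod (g x))\<^sup>2 + 2 * (cmod (h x))\<^sup>2)"
      by simp
  qed measurable
  then show ?thesis by (simp add: l2_space_def)
qed

lemma is_adjoint_unique:
  assumes A: "is_adjoint M M' T A" and B: "is_adjoint M M' T B" and h: "h \<in> l2_space M'"
  shows "l2_eq M (A h) (B h)"
proof -
  let ?d = "\<lambda>x. A h x - B h x"
  have Ah: "A h \<in> l2_space M" and Bh: "B h \<in> l2_space M"
    using A B h by (auto simp: is_adjoint_def bounded_operator_def)
  have d: "?d \<in> l2_space M" by (rule l2_diff[OF Ah Bh])
  have "l2_inner M ?d (A h) = l2_inner M ?d (B h)"
  proof -
    have "l2_inner M' (T ?d) h = l2_inner M ?d (A h)" "l2_inner M' (T ?d) h = l2_inner M ?d (B h)"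
      using A B h d unfolding is_adjoint_def by blast+
    then show ?thesis by simp
  qed
  then have "(LINT x|M. cnj (?d x) * A h x - cnj (?d x) * B h x) = 0"
    unfolding l2_inner_def
    using l2_integrable_mult[OF d Ah] l2_integrable_mult[OF d Bh]
    by (subst Bochner_Integration.integral_diff) auto
  moreover have "cnj (?d x) * A h x - cnj (?d x) * B h x = complex_of_real ((cmod (?d x))\<^sup>2)" for x
    unfolding complex_norm_square by (simp add: algebra_simps)
  ultimately have "(LINT x|M. complex_of_real ((cmod (?d x))\<^sup>2)) = 0" by simp
  then have "(LINT x|M. (cmod (?d x))\<^sup>2) = 0"
    by (simp only: integral_complex_of_real of_real_eq_0_iff)
  moreover have "integrable M (\<lambda>x. (cmod (?d x))\<^sup>2)" using d by (simp add: l2_space_def)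
  ultimately have "AE x in M. (cmod (?d x))\<^sup>2 = 0"
    by (subst (asm) integral_nonneg_eq_0_iff_AE) auto
  then show ?thesis by (auto simp: l2_eq_def)
qed

lemma adjoint_op_eq:
  assumes "is_adjoint M M' T A" and "h \<in> l2_space M'"
  shows "is_adjoint M M' T (adjoint_op M M' T)" "l2_eq M (adjoint_op M M' T h) (A h)"
proof -
  show *: "is_adjoint M M' T (adjoint_op M M' T)"
    unfolding adjoint_op_def by (rule someI[of "is_adjoint M M' T", OF assms(1)])
  show "l2_eq M (adjoint_op M M' T h) (A h)"
    by (rule is_adjoint_unique[OF * assms])
qed

lemma shift_prepend [simp]: "shift (prepend i w) = w"
  by (simp add: shift_def prepend_def)

lemma prepend_0 [simp]: "prepend i w 0 = i"
  by (simp add: prepend_def)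

lemma prepend_shift: "w 0 = i \<Longrightarrow> prepend i (shift w) = w"
  by (auto simp: shift_def prepend_def fun_eq_iff split: nat.split)

lemma coord_borel: "(\<lambda>w. w n) \<in> borel_measurable (borel :: (nat \<Rightarrow> nat) measure)"
  by (rule borel_measurable_continuous_onI)
    (rule continuous_on_product_then_coordinatewise[OF continuous_on_id])

locale monic =
  fixes N :: nat and \<mu> :: "(nat \<Rightarrow> nat) measure" and f :: "nat \<Rightarrow> (nat \<Rightarrow> nat) \<Rightarrow> complex"
  assumes monic: "monic_system N \<mu> f"
begin

sublocale finite_measure \<mu>
  using monic by (simp add: monic_system_def)

lemma sets_eq: "sets \<mu> = sets (restrict_space borel (words N))"
  using monic by (simp add: monic_system_def)

lemma space_eq: "space \<mu> = words N"
  using sets_eq_imp_space_eq[OF sets_eq] by (simp add: space_restrict_space)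

lemma measurable_eq: "measurable M \<mu> = measurable M (restrict_space borel (words N))"
  by (rule measurable_cong_sets[OF refl sets_eq])

lemma coord_measurable [measurable]: "(\<lambda>w. w n) \<in> \<mu> \<rightarrow>\<^sub>M (borel :: nat measure)"
  unfolding measurable_cong_sets[OF sets_eq refl]
  by (rule measurable_restrict_space1[OF coord_borel])

lemma shift_measurable [measurable]: "shift \<in> \<mu> \<rightarrow>\<^sub>M \<mu>"
  unfolding measurable_eq
proof (rule measurable_restrict_space2)
  show "shift \<in> space \<mu> \<rightarrow> words N" by (auto simp: space_eq words_def shift_def)
  show "shift \<in> borel_measurable \<mu>"
    by (rule measurable_coordinatewise_then_product) (simp add: shift_def coord_measurable)
qed

lemma prepend_words: "i < N \<Longrightarrow> w \<in> words N \<Longrightarrow> prepend i w \<in> words N"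
  by (auto simp: words_def prepend_def split: nat.split)

lemma prepend_measurable:
  assumes "i < N" shows "prepend i \<in> \<mu> \<rightarrow>\<^sub>M \<mu>"
  unfolding measurable_eq
proof (rule measurable_restrict_space2)
  show "prepend i \<in> space \<mu> \<rightarrow> words N" using assms by (auto simp: space_eq prepend_words)
  show "prepend i \<in> borel_measurable \<mu>"
  proof (rule measurable_coordinatewise_then_product)
    fix n show "(\<lambda>x. prepend i x n) \<in> borel_measurable \<mu>"
      by (cases n) (simp_all add: prepend_def coord_measurable)
  qed
qed

context
  fixes i assumes i: "i < N"
begin

lemmas prepend_measurable_i [measurable] = prepend_measurable[OF i]

lemma f_l2: "f i \<in> l2_space \<mu>"
  and f_nonzero: "AE x in \<mu>. x \<in> prepend i ` words N \<longrightarrow> f i x \<noteq> 0"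
  and f_ac: "absolutely_continuous \<mu> (distr \<mu> \<mu> (prepend i))"
  using monic i by (auto simp: monic_system_def)

lemma f_measurable [measurable]: "f i \<in> borel_measurable \<mu>"
  using f_l2 by (simp add: l2_space_def)

lemma distr_eq: "distr \<mu> \<mu> (prepend i) = density \<mu> (\<lambda>x. ennreal ((cmod (f i x))\<^sup>2))"
proof -
  have "distr \<mu> \<mu> (prepend i) = density \<mu> (RN_deriv \<mu> (distr \<mu> \<mu> (prepend i)))"
    using density_RN_deriv[OF f_ac] by simp
  also have "\<dots> = density \<mu> (\<lambda>x. ennreal ((cmod (f i x))\<^sup>2))"
    using monic i by (intro density_cong) (auto simp: monic_system_def)
  finally show ?thesis .
qed

lemma AE_prepend:
  assumes "AE x in \<mu>. P x" shows "AE x in \<mu>. P (prepend i x)"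
proof -
  have "AE x in distr \<mu> \<mu> (prepend i). P x"
    using f_ac assms by (rule absolutely_continuous_AE[rotated]) simp
  then show ?thesis by (rule AE_distrD[rotated]) measurable
qed

lemma AE_from_prepend:
  assumes [measurable]: "Measurable.pred \<mu> P" and "AE x in \<mu>. P (prepend i x)"
  shows "AE x in \<mu>. f i x \<noteq> 0 \<longrightarrow> P x"
proof -
  have "AE x in distr \<mu> \<mu> (prepend i). P x"
    using assms(2) by (subst AE_distr_iff) measurable
  then show ?thesis unfolding distr_eq by (subst (asm) AE_density) auto
qed

lemma f_support: "AE x in \<mu>. f i x \<noteq> 0 \<longleftrightarrow> x 0 = i"
proof -
  have 1: "AE x in \<mu>. f i x \<noteq> 0 \<longrightarrow> x 0 = i"
    by (rule AE_from_prepend) auto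
  have 2: "x \<in> prepend i ` words N" if "x \<in> space \<mu>" "x 0 = i" for x
  proof (rule image_eqI)
    show "x = prepend i (shift x)" using prepend_shift[of x i] that by simp
    show "shift x \<in> words N" using that by (auto simp: space_eq words_def shift_def)
  qed
  show ?thesis using 1 f_nonzero AE_space by eventually_elim (use 2 in auto)
qed

lemma integrable_prepend:
  fixes h :: "(nat \<Rightarrow> nat) \<Rightarrow> 'b::{banach, second_countable_topology}"
  assumes [measurable]: "h \<in> borel_measurable \<mu>"
  shows "integrable \<mu> (\<lambda>x. (cmod (f i x))\<^sup>2 *\<^sub>R h x) \<longleftrightarrow> integrable \<mu> (\<lambda>x. h (prepend i x))"
    and "(LINT x|\<mu>. (cmod (f i x))\<^sup>2 *\<^sub>R h x) = (LINT x|\<mu>. h (prepend i x))"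
proof -
  have "integrable \<mu> (\<lambda>x. h (prepend i x)) \<longleftrightarrow> integrable (distr \<mu> \<mu> (prepend i)) h"
    by (subst integrable_distr_eq) auto
  also have "\<dots> \<longleftrightarrow> integrable \<mu> (\<lambda>x. (cmod (f i x))\<^sup>2 *\<^sub>R h x)"
    unfolding distr_eq by (subst integrable_density) auto
  finally show "integrable \<mu> (\<lambda>x. (cmod (f i x))\<^sup>2 *\<^sub>R h x) \<longleftrightarrow> integrable \<mu> (\<lambda>x. h (prepend i x))"
    by simp
  have "(LINT x|\<mu>. h (prepend i x)) = integral\<^sup>L (distr \<mu> \<mu> (prepend i)) h"
    by (subst integral_distr) auto
  also have "\<dots> = (LINT x|\<mu>. (cmod (f i x))\<^sup>2 *\<^sub>R h x)"
    unfolding distr_eq by (subst integral_density) auto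
  finally show "(LINT x|\<mu>. (cmod (f i x))\<^sup>2 *\<^sub>R h x) = (LINT x|\<mu>. h (prepend i x))"
    by simp
qed

lemma rep_norm:
  assumes g: "g \<in> l2_space \<mu>"
  shows "monic_representation f i g \<in> l2_space \<mu>"
    and "l2_norm \<mu> (monic_representation f i g) = l2_norm \<mu> g"
proof -
  have [measurable]: "g \<in> borel_measurable \<mu>" using g by (simp add: l2_space_def)
  have *: "(cmod (f i x * g (shift x)))\<^sup>2 = (cmod (f i x))\<^sup>2 *\<^sub>R (cmod (g (shift x)))\<^sup>2" for x
    by (simp add: norm_mult power_mult_distrib)
  show "monic_representation f i g \<in> l2_space \<mu>"
    using g integrable_prepend(1)[of "\<lambda>x. (cmod (g (shift x)))\<^sup>2"]
    by (auto simp: l2_space_def monic_representation_def * simp del: scaleR_conv_of_real real_scaleR_def)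
  show "l2_norm \<mu> (monic_representation f i g) = l2_norm \<mu> g"
    using integrable_prepend(2)[of "\<lambda>x. (cmod (g (shift x)))\<^sup>2"]
    by (simp add: l2_norm_def monic_representation_def * del: real_scaleR_def)
qed

lemma rep_isometry: "isometry_op \<mu> \<mu> (monic_representation f i)"
proof -
  have "l2_eq \<mu> (monic_representation f i g) (monic_representation f i h)"
    if g: "g \<in> l2_space \<mu>" and h: "h \<in> l2_space \<mu>" and eq: "l2_eq \<mu> g h" for g h
  proof -
    have [measurable]: "g \<in> borel_measurable \<mu>" "h \<in> borel_measurable \<mu>"
      using g h by (simp_all add: l2_space_def)
    have "AE x in \<mu>. f i x \<noteq> 0 \<longrightarrow> g (shift x) = h (shift x)"
    proof (rule AE_from_prepend)
      show "Measurable.pred \<mu> (\<lambda>x. g (shift x) = h (shift x))"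
        unfolding eq_iff_diff_eq_0[of "g _"] by measurable
      show "AE x in \<mu>. g (shift (prepend i x)) = h (shift (prepend i x))"
        using eq by (simp add: l2_eq_def)
    qed
    then show ?thesis by (auto simp: l2_eq_def monic_representation_def)
  qed
  moreover have "\<exists>C. \<forall>g\<in>l2_space \<mu>. l2_norm \<mu> (monic_representation f i g) \<le> C * l2_norm \<mu> g"
    by (rule exI[of _ 1]) (simp add: rep_norm)
  ultimately show ?thesis
    by (auto simp: isometry_op_def bounded_operator_def rep_norm)
       (auto simp: monic_representation_def l2_eq_def algebra_simps)
qed

definition coisometry :: "((nat \<Rightarrow> nat) \<Rightarrow> complex) \<Rightarrow> (nat \<Rightarrow> nat) \<Rightarrow> complex" where
  "coisometry g = (\<lambda>x. g (prepend i x) / f i (prepend i x))"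

lemma coisometry_norm:
  assumes g: "g \<in> l2_space \<mu>"
  shows "coisometry g \<in> l2_space \<mu>" and "l2_norm \<mu> (coisometry g) \<le> l2_norm \<mu> g"
proof -
  have [measurable]: "g \<in> borel_measurable \<mu>" using g by (simp add: l2_space_def)
  have gi: "integrable \<mu> (\<lambda>x. (cmod (g x))\<^sup>2)" using g by (simp add: l2_space_def)
  let ?h = "\<lambda>x. (cmod (g x / f i x))\<^sup>2"
  have le: "(cmod (f i x))\<^sup>2 *\<^sub>R ?h x \<le> (cmod (g x))\<^sup>2" for x
    by (cases "f i x = 0") (simp_all add: norm_divide power_divide)
  have int: "integrable \<mu> (\<lambda>x. (cmod (f i x))\<^sup>2 *\<^sub>R ?h x)"
    using le by (intro Bochner_Integration.integrable_bound[OF gi]) auto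
  then show "coisometry g \<in> l2_space \<mu>"
    using integrable_prepend(1)[of ?h]
    by (auto simp: l2_space_def coisometry_def simp del: real_scaleR_def)
  have "(LINT x|\<mu>. (cmod (coisometry g x))\<^sup>2) = (LINT x|\<mu>. (cmod (f i x))\<^sup>2 *\<^sub>R ?h x)"
    by (subst integrable_prepend(2)) (auto simp: coisometry_def)
  also have "\<dots> \<le> (LINT x|\<mu>. (cmod (g x))\<^sup>2)"
    by (rule integral_mono[OF int gi le])
  finally show "l2_norm \<mu> (coisometry g) \<le> l2_norm \<mu> g" by (simp add: l2_norm_def)
qed

lemma coisometry_adjoint: "is_adjoint \<mu> \<mu> (monic_representation f i) coisometry"
proof -
  have "bounded_operator \<mu> \<mu> coisometry"
    unfolding bounded_operator_def
  proof (intro conjI ballI allI impI)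
    show "coisometry g \<in> l2_space \<mu>" if "g \<in> l2_space \<mu>" for g
      using that by (rule coisometry_norm)
    show "l2_eq \<mu> (coisometry g) (coisometry h)" if "l2_eq \<mu> g h" for g h
      using AE_prepend[OF that[unfolded l2_eq_def]] by (auto simp: l2_eq_def coisometry_def)
    show "\<exists>C. \<forall>g\<in>l2_space \<mu>. l2_norm \<mu> (coisometry g) \<le> C * l2_norm \<mu> g"
      by (rule exI[of _ 1]) (simp add: coisometry_norm)
  qed (auto simp: l2_eq_def coisometry_def add_divide_distrib)
  moreover have "l2_inner \<mu> (monic_representation f i g) h = l2_inner \<mu> g (coisometry h)"
    if g: "g \<in> l2_space \<mu>" and h: "h \<in> l2_space \<mu>" for g h
  proof -
    have [measurable]: "g \<in> borel_measurable \<mu>" "h \<in> borel_measurable \<mu>"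
      using g h by (simp_all add: l2_space_def)
    let ?k = "\<lambda>x. cnj (g (shift x)) * (h x / f i x)"
    have *: "cnj (f i x * g (shift x)) * h x = (cmod (f i x))\<^sup>2 *\<^sub>R ?k x" for x
      by (cases "f i x = 0") (simp_all add: scaleR_conv_of_real complex_norm_square field_simps del: of_real_power)
    have "l2_inner \<mu> (monic_representation f i g) h = (LINT x|\<mu>. (cmod (f i x))\<^sup>2 *\<^sub>R ?k x)"
      unfolding l2_inner_def monic_representation_def * ..
    also have "\<dots> = (LINT x|\<mu>. ?k (prepend i x))"
      by (rule integrable_prepend(2)) measurable
    also have "\<dots> = l2_inner \<mu> g (coisometry h)"
      by (simp add: l2_inner_def coisometry_def)
    finally show ?thesis .
  qed
  ultimately show ?thesis by (simp add: is_adjoint_def)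
qed

end

theorem cuntz: "cuntz_representation N \<mu> (monic_representation f)"
  unfolding cuntz_representation_def
proof (intro conjI allI impI ballI)
  show "isometry_op \<mu> \<mu> (monic_representation f i)" if "i < N" for i
    using that by (rule rep_isometry)
next
  fix i j g assume i: "i < N" and j: "j < N" and g: "g \<in> l2_space \<mu>"
  have "AE x in \<mu>. adjoint_op \<mu> \<mu> (monic_representation f i) (monic_representation f j g) x
      = coisometry i (monic_representation f j g) x"
    using adjoint_op_eq(2)[OF coisometry_adjoint[OF i] rep_norm(1)[OF j g]] by (simp add: l2_eq_def)
  moreover note AE_prepend[OF i f_support[OF i]] AE_prepend[OF i f_support[OF j]]
  ultimately show "l2_eq \<mu> (adjoint_op \<mu> \<mu> (monic_representation f i) (monic_representation f j g))
      (if i = j then g else (\<lambda>_. 0))"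
    unfolding l2_eq_def
    by eventually_elim (auto simp: coisometry_def[OF i] monic_representation_def)
next
  fix g assume g: "g \<in> l2_space \<mu>"
  have "AE x in \<mu>. monic_representation f i (adjoint_op \<mu> \<mu> (monic_representation f i) g) x
      = (if x 0 = i then g x else 0)" if i: "i < N" for i
  proof -
    let ?A = "adjoint_op \<mu> \<mu> (monic_representation f i) g"
    have A: "?A \<in> l2_space \<mu>"
      using adjoint_op_eq(1)[OF coisometry_adjoint[OF i] g] g
      by (auto simp: is_adjoint_def bounded_operator_def)
    have "l2_eq \<mu> (monic_representation f i ?A) (monic_representation f i (coisometry i g))"
      using rep_isometry[OF i] A coisometry_norm(1)[OF i g]
        adjoint_op_eq(2)[OF coisometry_adjoint[OF i] g]
      unfolding isometry_op_def bounded_operator_def by blast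
    then have "AE x in \<mu>. monic_representation f i ?A x = monic_representation f i (coisometry i g) x"
      by (simp add: l2_eq_def)
    then show ?thesis
      using f_support[OF i]
      by eventually_elim (auto simp: monic_representation_def coisometry_def[OF i] prepend_shift)
  qed
  then have "AE x in \<mu>. \<forall>i\<in>{..<N}.
      monic_representation f i (adjoint_op \<mu> \<mu> (monic_representation f i) g) x
      = (if x 0 = i then g x else 0)"
    by (intro AE_finite_allI) auto
  then show "l2_eq \<mu> (\<lambda>x. \<Sum>i<N. monic_representation f i
      (adjoint_op \<mu> \<mu> (monic_representation f i) g) x) g"
    unfolding l2_eq_def using AE_space
  proof eventually_elim
    case (elim x)
    then have "x 0 < N" by (auto simp: space_eq words_def)
    then show ?case using elim by simp
  qed
qed

end

lemma cuntz_representation_monic: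
  "monic_system N \<mu> f \<Longrightarrow> cuntz_representation N \<mu> (monic_representation f)"
  by (rule monic.cuntz[OF monic.intro])

end

theory Submission
  imports Defs
begin

text \<open>
  Decompose \<open>\<mu> = \<mu>\<^sub>a + \<mu>\<^sub>s\<close> with \<open>\<mu>\<^sub>a = k\<^sup>2 \<mu>'\<close> and \<open>\<mu>\<^sub>s\<close> carried by a \<open>\<mu>'\<close>-null set. The push-forwards
  along \<open>\<sigma>\<^sub>i\<close> respect this decomposition, so comparing densities gives
  \<open>k\<^sup>2 |f\<^sub>i|\<^sup>2 = |f'\<^sub>i|\<^sup>2 (k \<circ> \<sigma>)\<^sup>2\<close> almost everywhere with respect to \<open>\<mu>'\<close>. Nonnegativity lets
  us take square roots, and multiplication by \<open>k\<close> becomes an intertwiner, which vanishes only if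
  \<open>\<mu>\<^sub>a = 0\<close>. Conversely, the Borel sets \<open>A\<close> such that an intertwiner commutes with multiplication
  by \<open>1\<^sub>A\<close> form a \<open>\<sigma>\<close>-algebra closed under \<open>A \<mapsto> \<sigma>\<^sub>i(A)\<close>, since \<open>1\<^bsub>\<sigma>\<^sub>i(A)\<^esub> = S\<^sub>i 1\<^sub>A S\<^sub>i\<^sup>*\<close>. It contains
  all cylinders, hence all Borel sets. Taking \<open>A\<close> null for \<open>\<mu>\<close> with complement null for \<open>\<mu>'\<close>
  shows that the intertwiner is zero.
\<close>

section \<open>Lebesgue decomposition and the multiplication intertwiner\<close>

text \<open>An exhaustion argument: \<open>Z\<close> is an \<open>M'\<close>-null set of maximal
  \<open>M\<close>-measure, so what is left of \<open>M\<close> outside \<open>Z\<close> gives no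
  mass to \<open>M'\<close>-null sets and has a Radon-Nikodym density. The square root of that
  density is recorded because \<open>k\<close> itself will be the multiplier of an
  intertwiner.\<close>

lemma lebesgue_decomposition_sqrt_density:
  fixes M M' :: "'a measure"
  assumes "finite_measure M" and "finite_measure M'" and sets: "sets M = sets M'"
  obtains Z and k :: "'a \<Rightarrow> real"
  where "Z \<in> sets M" and "emeasure M' Z = 0"
    and "k \<in> borel_measurable M'" and "\<And>x. 0 \<le> k x"
    and "density M' (\<lambda>x. ennreal ((k x)\<^sup>2)) = density M (indicator (space M - Z))"
proof -
  interpret M: finite_measure M by fact
  interpret M': finite_measure M' by fact
  have "null_sets M' \<noteq> {}" by auto
  then obtain s :: "nat \<Rightarrow> ennreal"
    where s: "range s \<subseteq> emeasure M ` null_sets M'"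
      and sup_s: "Sup (emeasure M ` null_sets M') = Sup (range s)"
    using ennreal_Sup_countable_SUP[of "emeasure M ` null_sets M'"] by blast
  have "\<forall>n. \<exists>A. A \<in> null_sets M' \<and> s n = emeasure M A" using s by blast
  then obtain A where A: "\<And>n. A n \<in> null_sets M'" "\<And>n. s n = emeasure M (A n)" by metis
  \<comment> \<open>The \<open>A n\<close> approach the supremum of \<open>emeasure M\<close> over
    \<open>M'\<close>-null sets; their union is still null and attains it.\<close>
  define Z where "Z = (\<Union>n. A n)"
  have Z_null: "Z \<in> null_sets M'" unfolding Z_def using A(1) by (intro null_sets_UN) auto
  then have Z_sets [measurable]: "Z \<in> sets M" using sets by auto
  have A_le: "emeasure M (A n) \<le> emeasure M Z" for n
    by (rule emeasure_mono) (auto simp: Z_def Z_sets[unfolded Z_def])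
  have max: "emeasure M B \<le> emeasure M Z" if "B \<in> null_sets M'" for B
  proof -
    have "emeasure M B \<le> Sup (range s)" unfolding sup_s[symmetric] using that by (rule SUP_upper)
    also have "\<dots> \<le> emeasure M Z" by (rule SUP_least) (simp add: A(2) A_le)
    finally show ?thesis .
  qed
  let ?D = "density M (indicator (space M - Z))"
  have ac: "absolutely_continuous M' ?D"
    unfolding absolutely_continuous_def
  proof
    fix B assume B: "B \<in> null_sets M'"
    then have [measurable]: "B \<in> sets M" using sets by auto
    have "Z \<union> (B - Z) \<in> null_sets M'" using null_sets.Un[OF Z_null B] by simp
    then have "emeasure M (Z \<union> (B - Z)) \<le> emeasure M Z" by (rule max)
    moreover have "emeasure M (Z \<union> (B - Z)) = emeasure M Z + emeasure M (B - Z)"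
      by (rule plus_emeasure[symmetric]) auto
    \<comment> \<open>Adding \<open>B - Z\<close> to \<open>Z\<close> cannot increase the maximal
      measure; finiteness of \<open>emeasure M Z\<close> allows it to be cancelled.\<close>
    ultimately have 0: "emeasure M (B - Z) = 0"
      using M.emeasure_finite[of Z] by (simp add: ennreal_add_left_cancel_le[of _ _ 0, simplified])
    have "AE x in M. x \<notin> B - Z"
      by (rule AE_not_in) (simp add: null_setsI 0)
    then have "AE x in ?D. x \<notin> B"
      by (subst AE_density) (auto simp: indicator_def elim!: eventually_mono)
    then show "B \<in> null_sets ?D"
      by (subst AE_iff_null_sets) auto
  qed
  have setsD: "sets ?D = sets M'" using sets by simp
  interpret D: finite_measure ?D
    by (rule finite_measureI)
       (use M.emeasure_finite in \<open>auto simp: emeasure_density indicator_inter_arith[symmetric]\<close>)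
  \<comment> \<open>\<open>enn2real\<close> sends infinity to 0. This alters the density only on an
    \<open>M'\<close>-null set, because \<open>?D\<close> is a finite measure.\<close>
  define k where "k x = sqrt (enn2real (RN_deriv M' ?D x))" for x
  have "AE x in M'. RN_deriv M' ?D x \<noteq> \<infinity>"
    by (rule M'.RN_deriv_finite[OF D.sigma_finite_measure_axioms ac setsD])
  then have "density M' (\<lambda>x. ennreal ((k x)\<^sup>2)) = density M' (RN_deriv M' ?D)"
    by (intro density_cong) (auto simp: k_def less_top)
  also have "\<dots> = ?D" by (rule M'.density_RN_deriv[OF ac setsD])
  finally have "density M' (\<lambda>x. ennreal ((k x)\<^sup>2)) = ?D" .
  then show ?thesis
  proof (rule that[of Z k, rotated -1])
    show "k \<in> borel_measurable M'" unfolding k_def[abs_def] by measurable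
  qed (use Z_null in \<open>auto simp: k_def\<close>)
qed

section \<open>Compatibility of the Lebesgue decomposition with prefixing a letter\<close>

locale monic_pair = m: monic N \<mu> f + m': monic N \<mu>' f'
  for N :: nat and \<mu> \<mu>' :: "(nat \<Rightarrow> nat) measure"
    and f f' :: "nat \<Rightarrow> (nat \<Rightarrow> nat) \<Rightarrow> complex"
begin

lemma sets_pair: "sets \<mu> = sets \<mu>'" by (simp add: m.sets_eq m'.sets_eq)
lemma space_pair: "space \<mu> = space \<mu>'" by (simp add: m.space_eq m'.space_eq)

end

text \<open>\<open>Z\<close> carries the part of \<mu> singular to \<mu>', and the square of
  \<open>k\<close> is the density of the remaining part with respect to \<mu>'.\<close>

locale decomposed_monic_pair = monic_pair +
  fixes Z :: "(nat \<Rightarrow> nat) set" and k :: "(nat \<Rightarrow> nat) \<Rightarrow> real"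
  assumes nonneg: "i < N \<Longrightarrow> AE x in \<mu>. f i x \<in> \<real>\<^sub>\<ge>\<^sub>0"
    and nonneg': "i < N \<Longrightarrow> AE x in \<mu>'. f' i x \<in> \<real>\<^sub>\<ge>\<^sub>0"
    and Z_sets: "Z \<in> sets \<mu>" and Z_null: "emeasure \<mu>' Z = 0"
    and k_measurable': "k \<in> borel_measurable \<mu>'" and k_nonneg: "0 \<le> k x"
    and density_k: "density \<mu>' (\<lambda>x. ennreal ((k x)\<^sup>2)) = density \<mu> (indicator (space \<mu> - Z))"
begin

lemma measurable_pair: "measurable \<mu> M = measurable \<mu>' M"
  by (rule measurable_cong_sets[OF sets_pair refl])

lemmas [measurable] = Z_sets k_measurable'

lemma Z_sets' [measurable]: "Z \<in> sets \<mu>'" using Z_sets sets_pair by simp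

lemma k_measurable [measurable]: "k \<in> borel_measurable \<mu>"
  by (simp add: measurable_pair k_measurable')

lemma AE_notin_Z: "AE x in \<mu>'. x \<notin> Z"
  by (rule AE_not_in) (simp add: null_setsI Z_null)

text \<open>The two sides of \<open>density_k\<close> have the same null sets; a \<mu>-null set can
  therefore charge \<mu>' only where \<open>k\<close> vanishes.\<close>

lemma AE_transfer:
  assumes "AE x in \<mu>. P x" shows "AE x in \<mu>'. k x \<noteq> 0 \<longrightarrow> P x"
proof -
  have "AE x in density \<mu> (indicator (space \<mu> - Z)). P x"
    by (subst AE_density) (use assms in auto)
  then have "AE x in \<mu>'. 0 < ennreal ((k x)\<^sup>2) \<longrightarrow> P x"
    unfolding density_k[symmetric] by (subst (asm) AE_density) auto
  then show ?thesis by (simp add: ennreal_less_zero_iff)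
qed

lemma AE_transfer':
  assumes "AE x in \<mu>'. P x" shows "AE x in \<mu>. x \<notin> Z \<longrightarrow> P x"
proof -
  have "AE x in density \<mu>' (\<lambda>x. ennreal ((k x)\<^sup>2)). P x"
    by (subst AE_density) (use assms in auto)
  then have "AE x in \<mu>. 0 < (indicator (space \<mu> - Z) x :: ennreal) \<longrightarrow> P x"
    unfolding density_k by (subst (asm) AE_density) auto
  then show ?thesis using AE_space by eventually_elim auto
qed

lemma nn_integral_k:
  assumes [measurable]: "u \<in> borel_measurable \<mu>"
  shows "(\<integral>\<^sup>+x. ennreal ((k x)\<^sup>2) * u x \<partial>\<mu>') = (\<integral>\<^sup>+x. indicator (space \<mu> - Z) x * u x \<partial>\<mu>)"
proof -
  have [measurable]: "u \<in> borel_measurable \<mu>'" using assms by (simp add: measurable_pair)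
  have "(\<integral>\<^sup>+x. u x \<partial>density \<mu>' (\<lambda>x. ennreal ((k x)\<^sup>2))) = (\<integral>\<^sup>+x. u x \<partial>density \<mu> (indicator (space \<mu> - Z)))"
    by (simp only: density_k)
  then show ?thesis by (simp add: nn_integral_density)
qed

text \<open>This makes discarding \<open>Z\<close> commute with the push-forward along
  \<open>prepend i\<close>. Each implication is first a statement about \<mu>', where
  \<open>Z\<close> is null, and is then carried to \<mu> outside \<open>Z\<close>.\<close>

lemma AE_prepend_Z_iff:
  assumes i: "i < N"
  shows "AE x in \<mu>. prepend i x \<in> Z \<longleftrightarrow> x \<in> Z"
proof -
  note [measurable] = m.prepend_measurable[OF i] m'.prepend_measurable[OF i]
  have 1: "AE x in \<mu>. x \<notin> Z \<longrightarrow> prepend i x \<notin> Z"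
    by (rule AE_transfer'[OF m'.AE_prepend[OF i AE_notin_Z]])
  have "AE x in \<mu>'. f' i x \<noteq> 0 \<longrightarrow> shift x \<notin> Z"
    by (rule m'.AE_from_prepend[OF i]) (use AE_notin_Z in auto)
  \<comment> \<open>Nonvanishing of \<open>f' i\<close> on words beginning with \<open>i\<close>
    enters here: on them the null sets of the push-forward are \<mu>'-null.\<close>
  then have "AE x in \<mu>'. x 0 = i \<longrightarrow> shift x \<notin> Z"
    using m'.f_support[OF i] by eventually_elim auto
  from m.AE_prepend[OF i AE_transfer'[OF this]]
  have 2: "AE x in \<mu>. prepend i x \<notin> Z \<longrightarrow> x \<notin> Z" by simp
  show ?thesis using 1 2 by eventually_elim auto
qed

text \<open>The squared moduli of both sides are densities with respect to \<mu>' of one measure,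
  the push-forward along \<open>prepend i\<close> of \<mu> restricted to the complement of
  \<open>Z\<close>. Nonnegativity removes the squares and the phases.\<close>

lemma k_cocycle:
  assumes i: "i < N"
  shows "AE x in \<mu>'. complex_of_real (k x) * f i x = f' i x * complex_of_real (k (shift x))"
proof -
  note [measurable] = m.prepend_measurable[OF i] m'.prepend_measurable[OF i]
    m.f_measurable[OF i] m'.f_measurable[OF i]
  have fm [measurable]: "f i \<in> borel_measurable \<mu>'"
    using m.f_measurable[OF i] by (simp add: measurable_pair)
  let ?a = "\<lambda>x. ennreal ((k x)\<^sup>2) * ennreal ((cmod (f i x))\<^sup>2)"
  let ?b = "\<lambda>x. ennreal ((cmod (f' i x))\<^sup>2) * ennreal ((k (shift x))\<^sup>2)"
  have eq: "density \<mu>' ?a = density \<mu>' ?b"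
  proof (rule measure_eqI)
    fix A assume "A \<in> sets (density \<mu>' ?a)"
    then have A [measurable]: "A \<in> sets \<mu>'" "A \<in> sets \<mu>" using sets_pair by auto
    have "emeasure (density \<mu>' ?a) A
        = (\<integral>\<^sup>+x. ennreal ((k x)\<^sup>2) * (ennreal ((cmod (f i x))\<^sup>2) * indicator A x) \<partial>\<mu>')"
      by (subst emeasure_density) (auto simp: mult.assoc)
    also have "\<dots> = (\<integral>\<^sup>+x. indicator (space \<mu> - Z) x * (ennreal ((cmod (f i x))\<^sup>2) * indicator A x) \<partial>\<mu>)"
      by (rule nn_integral_k) measurable
    also have "\<dots> = (\<integral>\<^sup>+x. ennreal ((cmod (f i x))\<^sup>2) * (indicator (space \<mu> - Z) x * indicator A x) \<partial>\<mu>)"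
      by (simp add: ac_simps)
    also have "\<dots> = (\<integral>\<^sup>+x. indicator (space \<mu> - Z) x * indicator A x \<partial>density \<mu> (\<lambda>x. ennreal ((cmod (f i x))\<^sup>2)))"
      by (subst nn_integral_density) auto
    also have "\<dots> = (\<integral>\<^sup>+x. indicator (space \<mu> - Z) (prepend i x) * indicator A (prepend i x) \<partial>\<mu>)"
      unfolding m.distr_eq[OF i, symmetric] by (subst nn_integral_distr) auto
    also have "\<dots> = (\<integral>\<^sup>+x. indicator (space \<mu> - Z) x * indicator A (prepend i x) \<partial>\<mu>)"
      using AE_prepend_Z_iff[OF i] AE_space
      by (intro nn_integral_cong_AE, eventually_elim)
         (auto simp: indicator_def m.space_eq m.prepend_words[OF i])
    also have "\<dots> = (\<integral>\<^sup>+x. ennreal ((k x)\<^sup>2) * indicator A (prepend i x) \<partial>\<mu>')"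
      by (rule nn_integral_k[symmetric]) measurable
    \<comment> \<open>Since \<open>k x = k (shift (prepend i x))\<close>, the whole integrand is a
      function of \<open>prepend i x\<close>.\<close>
    also have "\<dots> = (\<integral>\<^sup>+x. ennreal ((k (shift x))\<^sup>2) * indicator A x \<partial>distr \<mu>' \<mu>' (prepend i))"
      by (subst nn_integral_distr) auto
    also have "\<dots> = (\<integral>\<^sup>+x. ?b x * indicator A x \<partial>\<mu>')"
      unfolding m'.distr_eq[OF i] by (subst nn_integral_density) (auto simp: mult.assoc)
    also have "\<dots> = emeasure (density \<mu>' ?b) A"
      by (subst emeasure_density) auto
    finally show "emeasure (density \<mu>' ?a) A = emeasure (density \<mu>' ?b) A" .
  qed simp
  have "AE x in \<mu>'. ?a x = ?b x"
    using eq by (subst (asm) m'.density_unique_iff) auto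
  then show ?thesis
    using AE_transfer[OF nonneg[OF i]] nonneg'[OF i]
  proof eventually_elim
    case (elim x)
    then have "(k x * cmod (f i x))\<^sup>2 = (cmod (f' i x) * k (shift x))\<^sup>2"
      by (simp add: power_mult_distrib ennreal_mult[symmetric])
    then have sq: "k x * cmod (f i x) = cmod (f' i x) * k (shift x)"
      by (rule power2_eq_imp_eq) (auto simp: k_nonneg)
    have real: "complex_of_real (cmod z) = z" if "z \<in> \<real>\<^sub>\<ge>\<^sub>0" for z
      using that by (auto elim!: nonneg_Reals_cases)
    \<comment> \<open>Nonnegativity of \<open>f i\<close> holds \<mu>-almost everywhere and so
      reaches \<mu>' only where \<open>k\<close> is nonzero; elsewhere both sides are 0.\<close>
    have "complex_of_real (k x) * f i x = complex_of_real (k x * cmod (f i x))"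
      using elim real by (cases "k x = 0") auto
    also have "\<dots> = f' i x * complex_of_real (k (shift x))"
      unfolding sq using elim real by simp
    finally show ?case .
  qed
qed

section \<open>Multiplication by \<open>k\<close> as an intertwiner\<close>

definition mult_k :: "((nat \<Rightarrow> nat) \<Rightarrow> complex) \<Rightarrow> (nat \<Rightarrow> nat) \<Rightarrow> complex" where
  "mult_k g = (\<lambda>x. complex_of_real (k x) * g x)"

text \<open>By \<open>nn_integral_k\<close>, the squared norm of \<open>mult_k g\<close> is the
  integral of the squared modulus of \<open>g\<close> over the complement of \<open>Z\<close>.
  Working with nonnegative integrals first yields integrability as well as the bound.\<close>

lemma mult_k_norm:
  assumes g: "g \<in> l2_space \<mu>"
  shows "mult_k g \<in> l2_space \<mu>'" and "l2_norm \<mu>' (mult_k g) \<le> l2_norm \<mu> g"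
proof -
  have [measurable]: "g \<in> borel_measurable \<mu>" using g by (simp add: l2_space_def)
  then have [measurable]: "g \<in> borel_measurable \<mu>'" by (simp add: measurable_pair)
  have gi: "integrable \<mu> (\<lambda>x. (cmod (g x))\<^sup>2)" using g by (simp add: l2_space_def)
  have le: "(\<integral>\<^sup>+x. ennreal ((cmod (mult_k g x))\<^sup>2) \<partial>\<mu>') \<le> (\<integral>\<^sup>+x. ennreal ((cmod (g x))\<^sup>2) \<partial>\<mu>)"
  proof -
    have "(\<integral>\<^sup>+x. ennreal ((cmod (mult_k g x))\<^sup>2) \<partial>\<mu>')
        = (\<integral>\<^sup>+x. ennreal ((k x)\<^sup>2) * ennreal ((cmod (g x))\<^sup>2) \<partial>\<mu>')"
      by (simp add: mult_k_def norm_mult power_mult_distrib ennreal_mult)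
    also have "\<dots> = (\<integral>\<^sup>+x. indicator (space \<mu> - Z) x * ennreal ((cmod (g x))\<^sup>2) \<partial>\<mu>)"
      by (rule nn_integral_k) measurable
    also have "\<dots> \<le> (\<integral>\<^sup>+x. ennreal ((cmod (g x))\<^sup>2) \<partial>\<mu>)"
      by (intro nn_integral_mono) (auto simp: indicator_def)
    finally show ?thesis .
  qed
  have [measurable]: "mult_k g \<in> borel_measurable \<mu>'" unfolding mult_k_def by measurable
  have fin: "(\<integral>\<^sup>+x. ennreal ((cmod (g x))\<^sup>2) \<partial>\<mu>) < \<infinity>"
    using gi by (simp add: integrable_iff_bounded)
  have int: "integrable \<mu>' (\<lambda>x. (cmod (mult_k g x))\<^sup>2)"
    using le_less_trans[OF le fin] by (simp add: integrable_iff_bounded)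
  then show "mult_k g \<in> l2_space \<mu>'" by (simp add: l2_space_def)
  have "ennreal (LINT x|\<mu>'. (cmod (mult_k g x))\<^sup>2) \<le> ennreal (LINT x|\<mu>. (cmod (g x))\<^sup>2)"
    using le nn_integral_eq_integral[OF int] nn_integral_eq_integral[OF gi] by simp
  then show "l2_norm \<mu>' (mult_k g) \<le> l2_norm \<mu> g" by (simp add: l2_norm_def)
qed

lemma mult_k_l2_eq: "l2_eq \<mu> g h \<Longrightarrow> l2_eq \<mu>' (mult_k g) (mult_k h)"
  using AE_transfer[of "\<lambda>x. g x = h x"] by (auto simp: l2_eq_def mult_k_def)

lemma bounded_mult_k: "bounded_operator \<mu> \<mu>' mult_k"
proof -
  have "\<exists>C. \<forall>g\<in>l2_space \<mu>. l2_norm \<mu>' (mult_k g) \<le> C * l2_norm \<mu> g"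
    by (rule exI[of _ 1]) (simp add: mult_k_norm)
  then show ?thesis
    unfolding bounded_operator_def
    by (auto simp: mult_k_norm mult_k_l2_eq)
       (auto simp: l2_eq_def mult_k_def algebra_simps)
qed

text \<open>The relation for the isometries is \<open>k_cocycle\<close>. For the adjoints, the
  explicit \<open>coisometry\<close> replaces \<open>adjoint_op\<close>, and the cocycle identity is
  read at \<open>prepend i x\<close>.\<close>

lemma intertwines_mult_k:
  "intertwines N \<mu> (monic_representation f) \<mu>' (monic_representation f') mult_k"
  unfolding intertwines_def
proof (intro allI impI ballI conjI)
  fix i g assume i: "i < N" and g: "g \<in> l2_space \<mu>"
  show "l2_eq \<mu>' (mult_k (monic_representation f i g)) (monic_representation f' i (mult_k g))"
    unfolding l2_eq_def using k_cocycle[OF i]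
    by eventually_elim (simp add: mult_k_def monic_representation_def mult.assoc[symmetric])
  have "l2_eq \<mu>' (mult_k (adjoint_op \<mu> \<mu> (monic_representation f i) g)) (mult_k (m.coisometry i g))"
    by (rule mult_k_l2_eq[OF adjoint_op_eq(2)[OF m.coisometry_adjoint[OF i] g]])
  moreover have "l2_eq \<mu>' (adjoint_op \<mu>' \<mu>' (monic_representation f' i) (mult_k g)) (m'.coisometry i (mult_k g))"
    by (rule adjoint_op_eq(2)[OF m'.coisometry_adjoint[OF i] mult_k_norm(1)[OF g]])
  ultimately show "l2_eq \<mu>' (mult_k (adjoint_op \<mu> \<mu> (monic_representation f i) g))
      (adjoint_op \<mu>' \<mu>' (monic_representation f' i) (mult_k g))"
    using m'.AE_prepend[OF i AE_transfer[OF m.f_support[OF i]]]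
      m'.AE_prepend[OF i m'.f_support[OF i]] m'.AE_prepend[OF i k_cocycle[OF i]]
    unfolding l2_eq_def
  proof eventually_elim
    case (elim x)
    let ?y = "prepend i x"
    have "complex_of_real (k x) * (g ?y / f i ?y) = complex_of_real (k ?y) * g ?y / f' i ?y"
    \<comment> \<open>\<open>f' i ?y\<close> is nonzero, so \<open>k ?y = 0\<close> forces
      \<open>k x = 0\<close> by the cocycle identity. Otherwise \<open>AE_transfer\<close> makes
      \<open>f i ?y\<close> nonzero too, and the division is legitimate.\<close>
    proof (cases "k ?y = 0")
      case True
      then have "k x = 0" using elim by auto
      then show ?thesis using True by simp
    next
      case False
      then show ?thesis using elim by (simp add: field_simps)
    qed
    then show ?case
      using elim(1,2) by (simp add: mult_k_def m.coisometry_def[OF i] m'.coisometry_def[OF i])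
  qed
qed

text \<open>Disjointness kills \<open>mult_k\<close>; evaluating it at the constant 1, which is
  square integrable as \<mu> is finite, gives \<open>k = 0\<close> almost everywhere. Then \<mu>
  lives on \<open>Z\<close>, and the complement of \<open>Z\<close> witnesses singularity.\<close>

lemma disjoint_imp_singular:
  assumes "disjoint_representations N \<mu> (monic_representation f) \<mu>' (monic_representation f')"
  shows "mutually_singular \<mu> \<mu>'"
proof -
  have "(\<lambda>_. 1) \<in> l2_space \<mu>" by (simp add: l2_space_def)
  then have "l2_eq \<mu>' (mult_k (\<lambda>_. 1)) (\<lambda>_. 0)"
    using assms bounded_mult_k intertwines_mult_k unfolding disjoint_representations_def by blast
  then have "AE x in \<mu>'. k x = 0" by (simp add: l2_eq_def mult_k_def)
  then have "(\<integral>\<^sup>+x. ennreal ((k x)\<^sup>2) * 1 \<partial>\<mu>') = 0"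
    by (subst nn_integral_0_iff_AE) auto
  then have "emeasure \<mu> (space \<mu> - Z) = 0"
    by (subst (asm) nn_integral_k) auto
  moreover have "space \<mu>' - (space \<mu> - Z) = Z"
    using sets.sets_into_space[OF Z_sets] by (auto simp: space_pair)
  ultimately show ?thesis
    unfolding mutually_singular_def
    by (intro bexI[of _ "space \<mu> - Z"]) (simp_all add: sets_pair[symmetric] sets.compl_sets[OF Z_sets] Z_null)
qed

end

section \<open>Intertwiners and multiplication by indicator functions\<close>

definition cut :: "'a set \<Rightarrow> ('a \<Rightarrow> complex) \<Rightarrow> 'a \<Rightarrow> complex" where
  "cut A g = (\<lambda>x. indicator A x * g x)"

lemma l2_norm_nonneg: "0 \<le> l2_norm M g"
  by (simp add: l2_norm_def)

lemma l2_norm_square: "(l2_norm M g)\<^sup>2 = (LINT x|M. (cmod (g x))\<^sup>2)"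
  by (simp add: l2_norm_def)

lemma l2_eq_cut: "l2_eq M g h \<Longrightarrow> l2_eq M (cut A g) (cut A h)"
  by (auto simp: l2_eq_def cut_def)

lemma l2_eq_sym: "l2_eq M g h \<Longrightarrow> l2_eq M h g"
  by (auto simp: l2_eq_def)

lemma l2_eq_trans [trans]: "l2_eq M g h \<Longrightarrow> l2_eq M h k \<Longrightarrow> l2_eq M g k"
  by (auto simp: l2_eq_def)

lemma cut_l2:
  assumes A [measurable]: "A \<in> sets M" and g: "g \<in> l2_space M"
  shows "cut A g \<in> l2_space M"
proof -
  have [measurable]: "g \<in> borel_measurable M" using g by (simp add: l2_space_def)
  have "integrable M (\<lambda>x. (cmod (g x))\<^sup>2)" using g by (simp add: l2_space_def)
  then have "integrable M (\<lambda>x. (cmod (cut A g x))\<^sup>2)"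
    by (rule Bochner_Integration.integrable_bound) (auto simp: cut_def indicator_def)
  then show ?thesis by (simp add: l2_space_def cut_def)
qed

text \<open>Dominated convergence with the squared modulus of \<open>g\<close> as majorant. It
  controls the tails in the step from finite to countable unions.\<close>

lemma cut_decreasing_tendsto_0:
  assumes R [measurable]: "\<And>n. R n \<in> sets M" and dec: "decseq R" and empty: "(\<Inter>n. R n) = {}"
    and g: "g \<in> l2_space M"
  shows "(\<lambda>n. (l2_norm M (cut (R n) g))\<^sup>2) \<longlonglongrightarrow> 0"
proof -
  have [measurable]: "g \<in> borel_measurable M" using g by (simp add: l2_space_def)
  have gi: "integrable M (\<lambda>x. (cmod (g x))\<^sup>2)" using g by (simp add: l2_space_def)
  have "(\<lambda>n. LINT x|M. (cmod (cut (R n) g x))\<^sup>2) \<longlonglongrightarrow> (LINT x|M. 0)"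
  proof (rule integral_dominated_convergence[OF _ _ gi])
    show "AE x in M. (\<lambda>n. (cmod (cut (R n) g x))\<^sup>2) \<longlonglongrightarrow> 0"
    proof (rule AE_I2)
      fix x
      obtain m where "x \<notin> R m" using empty by blast
      then have "eventually (\<lambda>n. (cmod (cut (R n) g x))\<^sup>2 = 0) sequentially"
        using dec by (intro eventually_sequentiallyI[of m]) (auto simp: cut_def decseq_def indicator_def)
      then show "(\<lambda>n. (cmod (cut (R n) g x))\<^sup>2) \<longlonglongrightarrow> 0"
        by (rule tendsto_eventually)
    qed
    show "AE x in M. norm ((cmod (cut (R n) g x))\<^sup>2) \<le> (cmod (g x))\<^sup>2" for n
      by (auto simp: cut_def indicator_def)
  qed (auto simp: cut_def)
  then show ?thesis by (simp add: l2_norm_square)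
qed

text \<open>A crude form of the triangle inequality, sufficient for estimates whose right-hand side
  tends to 0.\<close>

lemma l2_norm_diff_square_le:
  assumes g: "g \<in> l2_space M" and h: "h \<in> l2_space M"
  shows "(l2_norm M (\<lambda>x. g x - h x))\<^sup>2 \<le> 2 * (l2_norm M g)\<^sup>2 + 2 * (l2_norm M h)\<^sup>2"
proof -
  have gi: "integrable M (\<lambda>x. (cmod (g x))\<^sup>2)" and hi: "integrable M (\<lambda>x. (cmod (h x))\<^sup>2)"
    and di: "integrable M (\<lambda>x. (cmod (g x - h x))\<^sup>2)"
    using g h l2_diff[OF g h] by (simp_all add: l2_space_def)
  have "(cmod (a - b))\<^sup>2 \<le> 2 * (cmod a)\<^sup>2 + 2 * (cmod b)\<^sup>2" for a b
  proof -
    have "(cmod (a - b))\<^sup>2 \<le> (cmod a + cmod b)\<^sup>2"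
      by (rule power_mono[OF norm_triangle_ineq4]) simp
    moreover have "0 \<le> (cmod a - cmod b)\<^sup>2" by simp
    ultimately show ?thesis by (simp add: power2_eq_square algebra_simps)
  qed
  then have "(LINT x|M. (cmod (g x - h x))\<^sup>2) \<le> (LINT x|M. 2 * (cmod (g x))\<^sup>2 + 2 * (cmod (h x))\<^sup>2)"
    by (intro integral_mono) (auto simp: gi hi di)
  then show ?thesis by (simp add: l2_norm_square gi hi)
qed

lemma l2_norm_cong:
  assumes "l2_eq M g h" and "g \<in> l2_space M" and "h \<in> l2_space M"
  shows "l2_norm M g = l2_norm M h"
proof -
  have [measurable]: "g \<in> borel_measurable M" "h \<in> borel_measurable M"
    using assms by (simp_all add: l2_space_def)
  have "(LINT x|M. (cmod (g x))\<^sup>2) = (LINT x|M. (cmod (h x))\<^sup>2)"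
    using assms(1) by (intro integral_cong_AE) (auto simp: l2_eq_def)
  then show ?thesis by (simp add: l2_norm_def)
qed

lemma l2_norm_eq_0D:
  assumes g: "g \<in> l2_space M" and "(l2_norm M g)\<^sup>2 = 0"
  shows "l2_eq M g (\<lambda>_. 0)"
proof -
  have "integrable M (\<lambda>x. (cmod (g x))\<^sup>2)" using g by (simp add: l2_space_def)
  moreover have "(LINT x|M. (cmod (g x))\<^sup>2) = 0" using assms(2) unfolding l2_norm_square .
  ultimately have "AE x in M. (cmod (g x))\<^sup>2 = 0"
    by (subst (asm) integral_nonneg_eq_0_iff_AE) auto
  then show ?thesis by (simp add: l2_eq_def)
qed

text \<open>This is \<open>S_i 1_A S_i^* = 1_B\<close> with \<open>B\<close> the image of
  \<open>A\<close> under \<open>prepend i\<close>: the factors \<open>f i\<close> cancel on words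
  beginning with \<open>i\<close>, and \<open>f i\<close> vanishes on the others.\<close>

lemma (in monic) rep_cut_coisometry:
  assumes i: "i < N"
  shows "l2_eq \<mu> (monic_representation f i (cut A (coisometry i g)))
    (cut {x \<in> space \<mu>. x 0 = i \<and> shift x \<in> A} g)"
  unfolding l2_eq_def using f_support[OF i] AE_space
  by eventually_elim
    (auto simp: monic_representation_def cut_def coisometry_def[OF i] indicator_def prepend_shift)

section \<open>The \<sigma>-algebra of sets whose indicators commute with an intertwiner\<close>

locale monic_intertwiner = monic_pair +
  fixes W :: "((nat \<Rightarrow> nat) \<Rightarrow> complex) \<Rightarrow> (nat \<Rightarrow> nat) \<Rightarrow> complex"
  assumes bounded: "bounded_operator \<mu> \<mu>' W"
    and intertwines: "intertwines N \<mu> (monic_representation f) \<mu>' (monic_representation f') W"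
begin

lemma W_l2: "g \<in> l2_space \<mu> \<Longrightarrow> W g \<in> l2_space \<mu>'"
  and W_cong: "g \<in> l2_space \<mu> \<Longrightarrow> h \<in> l2_space \<mu> \<Longrightarrow> l2_eq \<mu> g h \<Longrightarrow> l2_eq \<mu>' (W g) (W h)"
  and W_add: "g \<in> l2_space \<mu> \<Longrightarrow> h \<in> l2_space \<mu> \<Longrightarrow>
    l2_eq \<mu>' (W (\<lambda>x. g x + h x)) (\<lambda>y. W g y + W h y)"
  and W_scale: "g \<in> l2_space \<mu> \<Longrightarrow> l2_eq \<mu>' (W (\<lambda>x. c * g x)) (\<lambda>y. c * W g y)"
  using bounded by (simp_all add: bounded_operator_def)

lemma W_zero: "l2_eq \<mu>' (W (\<lambda>_. 0)) (\<lambda>_. 0)"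
  using W_scale[of "\<lambda>_. 0" 0] by (simp add: l2_space_def)

text \<open>Turns the intertwining relation for the chosen adjoints into one for the explicit
  formula, using uniqueness of adjoints.\<close>

lemma W_coisometry:
  assumes i: "i < N" and g: "g \<in> l2_space \<mu>"
  shows "l2_eq \<mu>' (W (m.coisometry i g)) (m'.coisometry i (W g))"
proof -
  let ?A = "adjoint_op \<mu> \<mu> (monic_representation f i) g"
  have A: "?A \<in> l2_space \<mu>"
    using adjoint_op_eq(1)[OF m.coisometry_adjoint[OF i] g] g
    by (auto simp: is_adjoint_def bounded_operator_def)
  have "l2_eq \<mu>' (W (m.coisometry i g)) (W ?A)"
    by (rule l2_eq_sym[OF W_cong[OF A m.coisometry_norm(1)[OF i g]
          adjoint_op_eq(2)[OF m.coisometry_adjoint[OF i] g]]])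
  also have "l2_eq \<mu>' (W ?A) (adjoint_op \<mu>' \<mu>' (monic_representation f' i) (W g))"
    using intertwines i g by (simp add: intertwines_def)
  also have "l2_eq \<mu>' \<dots> (m'.coisometry i (W g))"
    by (rule adjoint_op_eq(2)[OF m'.coisometry_adjoint[OF i] W_l2[OF g]])
  finally show ?thesis .
qed

definition commuting_sets :: "(nat \<Rightarrow> nat) set set" where
  "commuting_sets = {A \<in> sets \<mu>. \<forall>g\<in>l2_space \<mu>. l2_eq \<mu>' (W (cut A g)) (cut A (W g))}"

lemma commuting_setsD:
  assumes "A \<in> commuting_sets"
  shows "A \<in> sets \<mu>" and "A \<in> sets \<mu>'"
    and "g \<in> l2_space \<mu> \<Longrightarrow> l2_eq \<mu>' (W (cut A g)) (cut A (W g))"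
  using assms by (auto simp: commuting_sets_def sets_pair)

lemma commuting_empty: "{} \<in> commuting_sets"
  using W_zero by (simp add: commuting_sets_def cut_def)

lemma commuting_compl:
  assumes A: "A \<in> commuting_sets" shows "space \<mu> - A \<in> commuting_sets"
proof -
  have "l2_eq \<mu>' (W (cut (space \<mu> - A) g)) (cut (space \<mu> - A) (W g))" if g: "g \<in> l2_space \<mu>" for g
  proof -
    let ?B = "space \<mu> - A"
    have cA: "cut A g \<in> l2_space \<mu>" and cB: "cut ?B g \<in> l2_space \<mu>"
      using cut_l2[OF _ g] commuting_setsD(1)[OF A] by auto
    have "l2_eq \<mu>' (W g) (W (\<lambda>x. cut ?B g x + cut A g x))"
    proof (rule W_cong[OF g])
      have "AE x in \<mu>. g x = cut ?B g x + cut A g x"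
        using AE_space by eventually_elim (auto simp: cut_def indicator_def)
      then show "l2_eq \<mu> g (\<lambda>x. cut ?B g x + cut A g x)" by (simp add: l2_eq_def)
      \<comment> \<open>The sum is rewritten as a difference so that \<open>l2_diff\<close>
        applies.\<close>
      have "(\<lambda>x. cut ?B g x + cut A g x) = (\<lambda>x. cut ?B g x - (\<lambda>x. (-1) * cut A g x) x)" by simp
      also have "\<dots> \<in> l2_space \<mu>"
        using cA by (intro l2_diff[OF cB]) (auto simp: l2_space_def)
      finally show "(\<lambda>x. cut ?B g x + cut A g x) \<in> l2_space \<mu>" .
    qed
    moreover note W_add[OF cB cA] commuting_setsD(3)[OF A g]
    moreover have "AE x in \<mu>'. x \<in> space \<mu>" unfolding space_pair by (rule AE_space)
    ultimately show ?thesis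
      unfolding l2_eq_def
      by eventually_elim (auto simp: cut_def indicator_def)
  qed
  then show ?thesis using commuting_setsD(1)[OF A] by (auto simp: commuting_sets_def)
qed

lemma commuting_Int:
  assumes A: "A \<in> commuting_sets" and B: "B \<in> commuting_sets"
  shows "A \<inter> B \<in> commuting_sets"
proof -
  have *: "cut (A \<inter> B) g = cut A (cut B g)" for g
    by (simp add: cut_def indicator_inter_arith mult.assoc)
  have "l2_eq \<mu>' (W (cut (A \<inter> B) g)) (cut (A \<inter> B) (W g))" if g: "g \<in> l2_space \<mu>" for g
    unfolding *
    using commuting_setsD(3)[OF A cut_l2[OF commuting_setsD(1)[OF B] g]]
      l2_eq_cut[OF commuting_setsD(3)[OF B g]]
    by (rule l2_eq_trans)
  then show ?thesis using commuting_setsD(1)[OF A] commuting_setsD(1)[OF B]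
    by (auto simp: commuting_sets_def)
qed

lemma commuting_Un:
  assumes A: "A \<in> commuting_sets" and B: "B \<in> commuting_sets"
  shows "A \<union> B \<in> commuting_sets"
proof -
  have "A \<union> B = space \<mu> - ((space \<mu> - A) \<inter> (space \<mu> - B))"
    using sets.sets_into_space commuting_setsD(1)[OF A] commuting_setsD(1)[OF B] by blast
  then show ?thesis using A B by (simp add: commuting_compl commuting_Int)
qed

lemma commuting_finite_UN:
  "finite I \<Longrightarrow> (\<And>i. i \<in> I \<Longrightarrow> A i \<in> commuting_sets) \<Longrightarrow> (\<Union>i\<in>I. A i) \<in> commuting_sets"
  by (induction I rule: finite_induct) (auto simp: commuting_empty commuting_Un)

text \<open>The finite unions \<open>V n\<close> commute with \<open>W\<close>, so the defect for
  the whole union equals the defect on the remainder \<open>R n\<close>. Boundedness of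
  \<open>W\<close> makes the latter arbitrarily small.\<close>

lemma commuting_UN:
  fixes A :: "nat \<Rightarrow> (nat \<Rightarrow> nat) set"
  assumes A: "\<And>n. A n \<in> commuting_sets"
  shows "(\<Union>n. A n) \<in> commuting_sets"
proof -
  let ?U = "\<Union>n. A n"
  define V where "V n = (\<Union>i<n. A i)" for n
  define R where "R n = ?U - V n" for n
  have V: "V n \<in> commuting_sets" for n
    unfolding V_def using A by (intro commuting_finite_UN) auto
  have U_sets: "?U \<in> sets \<mu>" using commuting_setsD(1)[OF A] by auto
  have R_sets: "R n \<in> sets \<mu>" "R n \<in> sets \<mu>'" for n
    using U_sets commuting_setsD(1)[OF V] sets_pair by (auto simp: R_def)
  have R_dec: "decseq R" by (auto simp: decseq_def R_def V_def)
  have R_empty: "(\<Inter>n. R n) = {}" by (auto simp: R_def V_def)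
  have "l2_eq \<mu>' (W (cut ?U g)) (cut ?U (W g))" if g: "g \<in> l2_space \<mu>" for g
  proof -
    let ?e = "\<lambda>x. W (cut ?U g) x - cut ?U (W g) x"
    have e: "?e \<in> l2_space \<mu>'"
      using U_sets sets_pair by (intro l2_diff W_l2 cut_l2 g) auto
    obtain C where C: "\<And>h. h \<in> l2_space \<mu> \<Longrightarrow> l2_norm \<mu>' (W h) \<le> C * l2_norm \<mu> h"
      using bounded unfolding bounded_operator_def by blast
    have bound: "(l2_norm \<mu>' ?e)\<^sup>2
        \<le> 2 * (C\<^sup>2 * (l2_norm \<mu> (cut (R n) g))\<^sup>2) + 2 * (l2_norm \<mu>' (cut (R n) (W g)))\<^sup>2" for n
    proof -
      let ?d = "\<lambda>x. W (cut (R n) g) x - cut (R n) (W g) x"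
      have cV: "cut (V n) g \<in> l2_space \<mu>" and cR: "cut (R n) g \<in> l2_space \<mu>"
        using cut_l2[OF _ g] commuting_setsD(1)[OF V] R_sets by auto
      have WR: "W (cut (R n) g) \<in> l2_space \<mu>'" "cut (R n) (W g) \<in> l2_space \<mu>'"
        using W_l2 cR cut_l2[OF R_sets(2) W_l2[OF g]] by auto
      have split: "cut ?U h = (\<lambda>x. cut (V n) h x + cut (R n) h x)" for h
        by (auto simp: cut_def fun_eq_iff indicator_def R_def V_def)
      have "l2_eq \<mu>' ?e ?d"
        using W_add[OF cV cR] commuting_setsD(3)[OF V g]
        unfolding l2_eq_def split by eventually_elim auto
      then have "l2_norm \<mu>' ?e = l2_norm \<mu>' ?d"
        by (rule l2_norm_cong[OF _ e l2_diff[OF WR]])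
      then have "(l2_norm \<mu>' ?e)\<^sup>2 \<le> 2 * (l2_norm \<mu>' (W (cut (R n) g)))\<^sup>2 + 2 * (l2_norm \<mu>' (cut (R n) (W g)))\<^sup>2"
        using l2_norm_diff_square_le[OF WR] by simp
      moreover have "(l2_norm \<mu>' (W (cut (R n) g)))\<^sup>2 \<le> (C * l2_norm \<mu> (cut (R n) g))\<^sup>2"
        by (rule power_mono[OF C[OF cR] l2_norm_nonneg])
      ultimately show ?thesis by (simp add: power_mult_distrib)
    qed
    have "(\<lambda>n. 2 * (C\<^sup>2 * (l2_norm \<mu> (cut (R n) g))\<^sup>2) + 2 * (l2_norm \<mu>' (cut (R n) (W g)))\<^sup>2)
        \<longlonglongrightarrow> 2 * (C\<^sup>2 * 0) + 2 * 0"
      by (intro tendsto_intros cut_decreasing_tendsto_0 R_sets R_dec R_empty g W_l2)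
    \<comment> \<open>The defect \<open>?e\<close> does not depend on \<open>n\<close>, so the bound
      survives passage to the limit.\<close>
    then have "(l2_norm \<mu>' ?e)\<^sup>2 \<le> 2 * (C\<^sup>2 * 0) + 2 * 0"
      by (rule LIMSEQ_le_const) (use bound in blast)
    then have "l2_eq \<mu>' ?e (\<lambda>_. 0)" by (intro l2_norm_eq_0D[OF e]) simp
    then show ?thesis by (simp add: l2_eq_def)
  qed
  then show ?thesis using U_sets by (simp add: commuting_sets_def)
qed

lemma commuting_sigma_algebra: "sigma_algebra (space \<mu>) commuting_sets"
  unfolding sigma_algebra_iff2
  using sets.sets_into_space commuting_setsD(1)
  by (auto simp: commuting_empty commuting_compl intro!: commuting_UN)

text \<open>\<open>W\<close> passes through each of the three factors of
  \<open>S_i 1_A S_i^*\<close>.\<close>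

lemma commuting_prepend:
  assumes i: "i < N" and A: "A \<in> commuting_sets"
  shows "{x \<in> space \<mu>. x 0 = i \<and> shift x \<in> A} \<in> commuting_sets"
proof -
  let ?B = "{x \<in> space \<mu>. x 0 = i \<and> shift x \<in> A}"
  have [measurable]: "A \<in> sets \<mu>" by (rule commuting_setsD(1)[OF A])
  have B: "?B \<in> sets \<mu>" by measurable
  have S'_cong: "l2_eq \<mu>' (monic_representation f' i g) (monic_representation f' i h)"
    if "g \<in> l2_space \<mu>'" "h \<in> l2_space \<mu>'" "l2_eq \<mu>' g h" for g h
    using m'.rep_isometry[OF i] that by (simp add: isometry_op_def bounded_operator_def)
  have "l2_eq \<mu>' (W (cut ?B g)) (cut ?B (W g))" if g: "g \<in> l2_space \<mu>" for g
  proof -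
    have C: "m.coisometry i g \<in> l2_space \<mu>" by (rule m.coisometry_norm(1)[OF i g])
    have C': "m'.coisometry i (W g) \<in> l2_space \<mu>'" by (rule m'.coisometry_norm(1)[OF i W_l2[OF g]])
    have cA: "cut A (m.coisometry i g) \<in> l2_space \<mu>" by (rule cut_l2[OF commuting_setsD(1)[OF A] C])
    have cA': "cut A (m'.coisometry i (W g)) \<in> l2_space \<mu>'" by (rule cut_l2[OF commuting_setsD(2)[OF A] C'])
    have "l2_eq \<mu>' (W (cut ?B g)) (W (monic_representation f i (cut A (m.coisometry i g))))"
      by (rule l2_eq_sym[OF W_cong[OF m.rep_norm(1)[OF i cA] cut_l2[OF B g] m.rep_cut_coisometry[OF i]]])
    also have "l2_eq \<mu>' \<dots> (monic_representation f' i (W (cut A (m.coisometry i g))))"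
      using intertwines i cA by (simp add: intertwines_def)
    also have "l2_eq \<mu>' \<dots> (monic_representation f' i (cut A (m'.coisometry i (W g))))"
      by (rule S'_cong[OF W_l2[OF cA] cA' l2_eq_trans[OF commuting_setsD(3)[OF A C] l2_eq_cut[OF W_coisometry[OF i g]]]])
    also have "l2_eq \<mu>' \<dots> (cut ?B (W g))"
      using m'.rep_cut_coisometry[OF i] by (simp add: space_pair)
    finally show ?thesis .
  qed
  then show ?thesis using B by (simp add: commuting_sets_def)
qed

text \<open>Prefixing a letter moves a condition on coordinate \<open>n\<close> to coordinate
  \<open>Suc n\<close>; the union over all first letters removes the constraint on coordinate 0. In
  the base case a letter \<open>j\<close> outside the alphabet gives the empty set.\<close>

lemma commuting_coordinate: "{x \<in> space \<mu>. x n = j} \<in> commuting_sets"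
proof (induction n)
  case 0
  show ?case
  proof (cases "j < N")
    case True
    have "space \<mu> \<in> commuting_sets" using commuting_compl[OF commuting_empty] by simp
    from commuting_prepend[OF True this]
    show ?thesis by (rule back_subst[of "\<lambda>A. A \<in> commuting_sets"])
      (auto simp: m.space_eq words_def shift_def)
  next
    case False
    then have "{x \<in> space \<mu>. x 0 = j} = {}" by (auto simp: m.space_eq words_def)
    then show ?thesis using commuting_empty by metis
  qed
next
  case (Suc n)
  have eq: "{x \<in> space \<mu>. x (Suc n) = j}
      = (\<Union>i<N. {x \<in> space \<mu>. x 0 = i \<and> shift x \<in> {x \<in> space \<mu>. x n = j}})"
    by (auto simp: m.space_eq words_def shift_def)
  show ?case unfolding eq by (intro commuting_finite_UN commuting_prepend[OF _ Suc]) auto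
qed

lemma commuting_sets_eq: "commuting_sets = sets \<mu>"
proof
  show "commuting_sets \<subseteq> sets \<mu>" using commuting_setsD(1) by blast
  interpret sigma_algebra "space \<mu>" commuting_sets by (rule commuting_sigma_algebra)
  define D where "D = sigma (space \<mu>) commuting_sets"
  have D: "space D = space \<mu>" "sets D = commuting_sets"
    using space_closed by (simp_all add: D_def sigma_sets_eq)
  \<comment> \<open>Measurability of the identity from \<open>D\<close> to \<open>borel\<close> says
    that \<open>D\<close> contains the traces of all Borel sets. It is checked coordinatewise, and
    there on single letters since the values are countable and discrete.\<close>
  have "(\<lambda>x. x) \<in> borel_measurable D"
  proof (rule measurable_coordinatewise_then_product)
    fix n
    have "(\<lambda>x. x n) -` {j} \<inter> space D \<in> sets D" for j
      using commuting_coordinate[of n j] by (simp add: D vimage_def Int_def conj_commute)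
    then show "(\<lambda>x. x n) \<in> borel_measurable D"
      by (simp add: measurable_cong_sets[OF refl sets_borel_eq_count_space] measurable_count_space_eq2_countable)
  qed
  show "sets \<mu> \<subseteq> commuting_sets"
  proof
    fix B assume "B \<in> sets \<mu>"
    then obtain B' where "B' \<in> sets borel" "B = words N \<inter> B'"
      by (auto simp: m.sets_eq sets_restrict_space)
    then show "B \<in> commuting_sets"
      using measurable_sets[OF \<open>(\<lambda>x. x) \<in> borel_measurable D\<close>, of B']
      by (simp add: D m.space_eq vimage_def Int_commute)
  qed
qed

text \<open>If \<open>A\<close> is \<mu>-null and carries \<mu>', then almost everywhere
  \<open>W g = cut A (W g) = W (cut A g) = W 0 = 0\<close>, where 0 is the zero function.\<close>

lemma singular_imp_zero:
  assumes "mutually_singular \<mu> \<mu>'" and g: "g \<in> l2_space \<mu>"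
  shows "l2_eq \<mu>' (W g) (\<lambda>_. 0)"
proof -
  obtain A where A: "A \<in> sets \<mu>" "A \<in> sets \<mu>'" "emeasure \<mu> A = 0" "emeasure \<mu>' (space \<mu>' - A) = 0"
    using assms by (auto simp: mutually_singular_def)
  have zero: "(\<lambda>_. 0) \<in> l2_space \<mu>" by (simp add: l2_space_def)
  have "AE x in \<mu>. x \<notin> A" by (rule AE_not_in) (simp add: A null_setsI)
  then have "l2_eq \<mu> (cut A g) (\<lambda>_. 0)"
    unfolding l2_eq_def by eventually_elim (simp add: cut_def)
  then have "l2_eq \<mu>' (W (cut A g)) (W (\<lambda>_. 0))"
    by (rule W_cong[OF cut_l2[OF A(1) g] zero])
  moreover have "l2_eq \<mu>' (W (cut A g)) (cut A (W g))"
    using commuting_setsD(3)[OF _ g] A(1) by (simp add: commuting_sets_eq)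
  moreover have "AE x in \<mu>'. x \<notin> space \<mu>' - A"
    by (rule AE_not_in) (use A in \<open>auto intro: null_setsI\<close>)
  ultimately show ?thesis
    using W_zero AE_space unfolding l2_eq_def by eventually_elim (auto simp: cut_def)
qed

end

theorem theorem2p12:
  fixes N :: nat
    and \<mu> \<mu>' :: "(nat \<Rightarrow> nat) measure"
    and f f' :: "nat \<Rightarrow> (nat \<Rightarrow> nat) \<Rightarrow> complex"
  assumes "N \<ge> 2"
    and "nonnegative_monic_system N \<mu> f"
    and "nonnegative_monic_system N \<mu>' f'"
  shows "disjoint_representations N \<mu> (monic_representation f) \<mu>' (monic_representation f')
    \<longleftrightarrow> mutually_singular \<mu> \<mu>'"
proof -
  have m: "monic_system N \<mu> f" "monic_system N \<mu>' f'"
    and nonneg: "\<And>i. i < N \<Longrightarrow> AE x in \<mu>. f i x \<in> \<real>\<^sub>\<ge>\<^sub>0" "\<And>i. i < N \<Longrightarrow> AE x in \<mu>'. f' i x \<in> \<real>\<^sub>\<ge>\<^sub>0"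
    using assms(2,3) by (simp_all add: nonnegative_monic_system_def)
  interpret monic_pair N \<mu> \<mu>' f f'
    by (intro monic_pair.intro monic.intro m)
  show ?thesis
  proof
    assume disjoint: "disjoint_representations N \<mu> (monic_representation f) \<mu>' (monic_representation f')"
    obtain Z and k :: "(nat \<Rightarrow> nat) \<Rightarrow> real" where Zk: "Z \<in> sets \<mu>" "emeasure \<mu>' Z = 0"
      "k \<in> borel_measurable \<mu>'" "\<And>x. 0 \<le> k x"
      "density \<mu>' (\<lambda>x. ennreal ((k x)\<^sup>2)) = density \<mu> (indicator (space \<mu> - Z))"
      using lebesgue_decomposition_sqrt_density[OF m.finite_measure_axioms m'.finite_measure_axioms sets_pair]
      by blast
    interpret decomposed_monic_pair N \<mu> \<mu>' f f' Z k
      by unfold_locales (use nonneg Zk in auto)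
    show "mutually_singular \<mu> \<mu>'" by (rule disjoint_imp_singular[OF disjoint])
  next
    assume singular: "mutually_singular \<mu> \<mu>'"
    show "disjoint_representations N \<mu> (monic_representation f) \<mu>' (monic_representation f')"
      unfolding disjoint_representations_def
    proof (intro allI impI ballI)
      fix W g
      assume W: "bounded_operator \<mu> \<mu>' W \<and> intertwines N \<mu> (monic_representation f) \<mu>' (monic_representation f') W"
        and g: "g \<in> l2_space \<mu>"
      interpret monic_intertwiner N \<mu> \<mu>' f f' W
        by unfold_locales (use W in auto)
      show "l2_eq \<mu>' (W g) (\<lambda>_. 0)" by (rule singular_imp_zero[OF singular g])
    qed
  qed
qed

end
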